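(* Let $(X,\mathcal A,\mu,T)$ be a conservative ergodic infinite measure preserving system (as in the context). Let $N_1,\dots,N_n$ be $n$ $T$-point processes defined on the ergodic system $(\Omega,\mathscr F,\mathbb P,S)$, having moments of all orders. Assume there exist a real number $c>0$, integers $2\le j\le n$ and $k_2,\dots,k_j$, and a $T^{\times(n-j)}$-invariant, $\sigma$-finite measure $\nu\neq0$ on $X^{n-j}$ such that, for any sets $A_1,\dots,A_n$ in $\mathcal A_f$, $$\mathbb E\left[N_1(A_1)\cdots N_n(A_n)\right]\ \ge\ c\,\mu\left(A_1\cap T^{-k_2}A_2\cap\cdots\cap T^{-k_j}A_j\right)\nu\left(A_{j+1}\times\cdots\times A_n\right).$$ Then, for any $A\in\mathcal A_f$, $$\mathbb P\left(A\cap N_1\cap T^{-k_2}N_2\cap\cdots\cap T^{-k_j}N_j\neq\emptyset\right)>0.$$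
   Context: Setting. $X$ is a complete separable metric space with Borel $\sigma$-algebra $\mathcal A$; $\mu$ is a measure on $(X,\mathcal A)$ that is boundedly finite (finite on bounded Borel sets), with $\mu(X)=\infty$; $T:X\to X$ is invertible and preserves $\mu$, and $(X,\mathcal A,\mu,T)$ is conservative and ergodic. Put $\mathcal A_f=\{A\in\mathcal A: 0<\mu(A)<\infty\}$. $X^*$ is the set of boundedly finite simple counting measures $\xi=\sum_{i\in I}\delta_{x_i}$ ($I$ at most countable, $x_i\ne x_j$ for $i\neq j$), identified with the corresponding sets of points, and $\mathcal A^*$ is the $\sigma$-algebra on $X^*$ generated by the maps $\xi\mapsto \xi(A)$, $A$ bounded Borel. $T$-point process. $(\Omega,\mathscr F,\mathbb P)$ is a probability space and $S$ an invertible measure preserving transformation of it. A $T$-point process defined on $(\Omega,\mathscr F,\mathbb P,S)$ is a measurable map $N:\Omega\to X^*$ such that (i) for each $A\in\mathcal A$ with $\mu(A)=0$, $N(\omega)(A)=0$ for $\mathbb P$-a.e. $\omega$; (ii) for $\mathbb P$-a.e. $\omega$, for all $A\in\mathcal A$, $N(S\omega)(A)=N(\omega)(T^{-1}A)$. It has moments of all orders if $\mathbb E[N(A)^m]<\infty$ for all $m\ge1$ and $A\in\mathcal A_f$. Convention: when $j=n$, $X^{n-j}$ is a single point and the factor $\nu(A_{j+1}\times\cdots\times A_n)$ is a positive constant. $T^{-k}N_i$ denotes the set $\{x: T^kx\in N_i\}$. *)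

theory Defs
  imports "HOL-Probability.Probability"
begin

section \<open>Measure preserving systems\<close>

definition invertible_mpt :: "'a measure \<Rightarrow> ('a \<Rightarrow> 'a) \<Rightarrow> bool" where
  "invertible_mpt M T \<longleftrightarrow>
     bij_betw T (space M) (space M) \<and>
     T \<in> measurable M M \<and>
     the_inv_into (space M) T \<in> measurable M M \<and>
     distr M M T = M"

definition ergodic :: "'a measure \<Rightarrow> ('a \<Rightarrow> 'a) \<Rightarrow> bool" where
  "ergodic M T \<longleftrightarrow>
     (\<forall>A\<in>sets M. T -` A \<inter> space M = A \<longrightarrow> emeasure M A = 0 \<or> emeasure M (space M - A) = 0)"

text \<open>Conservativity: every wandering set is a null set.\<close>

definition conservative :: "'a measure \<Rightarrow> ('a \<Rightarrow> 'a) \<Rightarrow> bool" where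
  "conservative M T \<longleftrightarrow>
     (\<forall>W\<in>sets M. disjoint_family (\<lambda>m::nat. (T ^^ m) -` W \<inter> space M) \<longrightarrow> emeasure M W = 0)"

definition boundedly_finite :: "'a::metric_space measure \<Rightarrow> bool" where
  "boundedly_finite M \<longleftrightarrow> (\<forall>B\<in>sets borel. bounded B \<longrightarrow> emeasure M B < \<infinity>)"

text \<open>The space \<open>X\<close> is the whole type, which carries a complete separable metric
  by its class.\<close>

definition infinite_system :: "'a::polish_space measure \<Rightarrow> ('a \<Rightarrow> 'a) \<Rightarrow> bool" where
  "infinite_system \<mu> T \<longleftrightarrow>
     sets \<mu> = sets borel \<and>
     boundedly_finite \<mu> \<and>
     emeasure \<mu> UNIV = \<infinity> \<and>
     invertible_mpt \<mu> T \<and>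
     conservative \<mu> T \<and>
     ergodic \<mu> T"

definition fin_pos_sets :: "'a measure \<Rightarrow> 'a set set" where
  "fin_pos_sets \<mu> = {A \<in> sets \<mu>. 0 < emeasure \<mu> A \<and> emeasure \<mu> A < \<infinity>}"

text \<open>Powers with an integer exponent, of a bijection of the whole type.\<close>

definition int_iter :: "('a \<Rightarrow> 'a) \<Rightarrow> int \<Rightarrow> 'a \<Rightarrow> 'a" where
  "int_iter T k = (if 0 \<le> k then T ^^ nat k else inv T ^^ nat (- k))"


section \<open>Point processes\<close>

text \<open>A simple counting measure \<open>\<xi> = (\<Sum>i\<in>I. \<delta>\<^bsub>x i\<^esub>)\<close> is represented by its set of points
  \<open>\<xi> = {x i | i. i \<in> I}\<close>; the value \<open>\<xi>(A)\<close> is then the (possibly infinite) number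
  of points of \<open>\<xi>\<close> in \<open>A\<close>.\<close>

definition num_points :: "'a set \<Rightarrow> 'a set \<Rightarrow> ennreal" where
  "num_points \<xi> A = emeasure (count_space UNIV) (\<xi> \<inter> A)"

definition configurations :: "'a::metric_space set set" where
  "configurations =
     {\<xi>. countable \<xi> \<and> (\<forall>B\<in>sets borel. bounded B \<longrightarrow> num_points \<xi> B < \<infinity>)}"

definition config_space :: "'a::metric_space set measure" where
  "config_space = sigma configurations
     {{\<xi> \<in> configurations. num_points \<xi> A \<in> E} | A E.
        A \<in> sets borel \<and> bounded A \<and> E \<in> sets borel}"

definition point_process ::
  "'a::polish_space measure \<Rightarrow> ('a \<Rightarrow> 'a) \<Rightarrow> 'w measure \<Rightarrow> ('w \<Rightarrow> 'w) \<Rightarrow> ('w \<Rightarrow> 'a set) \<Rightarrow> bool" where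
  "point_process \<mu> T P S N \<longleftrightarrow>
     N \<in> measurable P config_space \<and>
     (\<forall>A\<in>sets \<mu>. emeasure \<mu> A = 0 \<longrightarrow> (AE \<omega> in P. num_points (N \<omega>) A = 0)) \<and>
     (AE \<omega> in P. \<forall>A\<in>sets \<mu>. num_points (N (S \<omega>)) A = num_points (N \<omega>) (T -` A))"

definition moments_of_all_orders :: "'a measure \<Rightarrow> 'w measure \<Rightarrow> ('w \<Rightarrow> 'a set) \<Rightarrow> bool" where
  "moments_of_all_orders \<mu> P N \<longleftrightarrow>
     (\<forall>m\<ge>(1::nat). \<forall>A\<in>fin_pos_sets \<mu>. (\<integral>\<^sup>+\<omega>. num_points (N \<omega>) A ^ m \<partial>P) < \<infinity>)"


section \<open>Invariant measures on finite powers\<close>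

text \<open>The power of \<open>X\<close> with coordinates in \<open>I\<close> is the product space over \<open>I\<close>. For \<open>I = {}\<close> this
  is a one-point space, on which a nonzero \<open>\<sigma>\<close>-finite measure is a positive finite constant.\<close>

definition product_invariant ::
  "('a::topological_space \<Rightarrow> 'a) \<Rightarrow> 'i set \<Rightarrow> ('i \<Rightarrow> 'a) measure \<Rightarrow> bool" where
  "product_invariant T I \<nu> \<longleftrightarrow>
     sets \<nu> = sets (Pi\<^sub>M I (\<lambda>_. borel)) \<and>
     distr \<nu> \<nu> (\<lambda>x. \<lambda>i\<in>I. T (x i)) = \<nu>"

end

theory Submission
  imports Defs
begin

text \<open>
  Write \<open>g\<^sub>1 = id\<close>, \<open>g\<^sub>i = T\<^sup>k\<close> with \<open>k = k\<^sub>i\<close> for \<open>2 \<le> i \<le> j\<close>, and \<open>F\<^sub>i = g\<^sub>i\<^sup>-\<^sup>1 N\<^sub>i\<close>. The theorem says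
  that the point sets \<open>F\<^sub>1, \<dots>, F\<^sub>j\<close> have a common point in \<open>A\<close> with positive probability. The idea
  is to count common points by means of finer and finer partitions. Cut a set \<open>D\<close> into finitely
  many cells \<open>Q\<close> and consider
  \<open>Z = (\<Sum>Q. F\<^sub>1(Q) \<cdots> F\<^sub>j(Q))\<close>, the number of \<open>j\<close>-tuples, one point from each \<open>F\<^sub>i\<close>, lying in one
  common cell. Two facts about \<open>Z\<close> conflict if there is almost surely no common point.

  On the one hand, apply the moment inequality to the sets \<open>g\<^sub>i Q\<close> for \<open>i \<le> j\<close> and to a fixed ball
  \<open>B\<close> for \<open>i > j\<close>. Since the \<open>g\<^sub>i Q\<close> pull back to \<open>Q\<close>, it gives \<open>c \<mu>(Q) \<nu>(B \<times> \<cdots> \<times> B)\<close>, and this is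
  additive in \<open>Q\<close>. So \<open>E[Z W] \<ge> c \<mu>(D) \<nu>(B \<times> \<cdots> \<times> B)\<close> with \<open>W = N\<^sub>j\<^sub>+\<^sub>1(B) \<cdots> N\<^sub>n(B)\<close>, a bound which
  does not depend on the partition and is positive for a large ball.

  On the other hand, if the partitions eventually separate any two points, then any finitely many
  points eventually lie in different cells. Hence \<open>Z = 0\<close> for all fine partitions whenever the
  finite sets \<open>F\<^sub>i \<inter> D\<close> have no common point (\<open>eventually_cell_tuples_zero\<close>). Since \<open>Z\<close> is at
  most \<open>F\<^sub>1(D) \<cdots> F\<^sub>j(D)\<close>, and the moment assumption makes \<open>F\<^sub>1(D) \<cdots> F\<^sub>j(D) W\<close> integrable, dominated
  convergence would yield \<open>E[Z W] \<rightarrow> 0\<close>. This contradiction is \<open>coincidence_positive\<close>.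

  The same quantity shows that coincidence is an event: there is a common point in \<open>D\<close> iff \<open>Z \<noteq> 0\<close>
  for all the partitions. As \<open>A\<close> may be unbounded, it is exhausted by sets \<open>D\<close> all of whose images
  \<open>g\<^sub>i D\<close> are bounded; there the counts are measurable and finite everywhere.
\<close>

section \<open>Invertible measure preserving maps\<close>

lemma invertible_mpt_id: "invertible_mpt M (id :: 'a \<Rightarrow> 'a)" if "space M = UNIV"
proof -
  have "the_inv_into UNIV (id :: 'a \<Rightarrow> 'a) = id"
    by (auto simp: fun_eq_iff the_inv_into_f_eq)
  then show ?thesis
    using that by (simp add: invertible_mpt_def distr_id2 id_def bij_betw_def)
qed

lemma invertible_mpt_UNIV_iff:
  assumes "space M = UNIV"
  shows "invertible_mpt M T \<longleftrightarrow>
    bij T \<and> T \<in> measurable M M \<and> inv T \<in> measurable M M \<and> distr M M T = M"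
proof -
  have "the_inv_into UNIV T = inv T" if "bij T"
    using that by (auto simp: fun_eq_iff bij_def surj_f_inv_f intro!: the_inv_into_f_eq)
  then show ?thesis
    using assms by (auto simp: invertible_mpt_def)
qed

lemma invertible_mpt_comp:
  assumes "space M = UNIV" "invertible_mpt M T" "invertible_mpt M R"
  shows "invertible_mpt M (T \<circ> R)"
proof -
  have "distr M M (T \<circ> R) = distr (distr M M R) M T"
    using assms by (subst distr_distr) (auto simp: invertible_mpt_UNIV_iff)
  then show ?thesis
    using assms by (auto simp: invertible_mpt_UNIV_iff bij_comp o_inv_distrib)
qed

lemma invertible_mpt_inv:
  assumes "space M = UNIV" "invertible_mpt M T"
  shows "invertible_mpt M (inv T)"
proof -
  have "distr M M (inv T) = distr (distr M M T) M (inv T)"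
    using assms by (simp add: invertible_mpt_UNIV_iff)
  also have "\<dots> = distr M M (inv T \<circ> T)"
    using assms by (subst distr_distr) (auto simp: invertible_mpt_UNIV_iff)
  also have "\<dots> = M"
    using assms by (simp add: invertible_mpt_UNIV_iff bij_is_inj distr_id2 id_def)
  finally show ?thesis
    using assms by (simp add: invertible_mpt_UNIV_iff bij_imp_bij_inv inv_inv_eq)
qed

lemma invertible_mpt_int_iter:
  assumes "space M = UNIV" "invertible_mpt M T"
  shows "invertible_mpt M (int_iter T k)"
proof -
  have "invertible_mpt M (R ^^ m)" if "invertible_mpt M R" for R and m :: nat
    using that by (induction m) (simp_all add: assms(1) invertible_mpt_id invertible_mpt_comp)
  then show ?thesis
    using assms by (simp add: int_iter_def invertible_mpt_inv)
qed

lemma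
  assumes "space M = UNIV" "invertible_mpt M T" "Q \<in> sets M"
  shows invertible_mpt_image_sets: "T ` Q \<in> sets M"
    and invertible_mpt_emeasure_image: "emeasure M (T ` Q) = emeasure M Q"
proof -
  note T = assms(2)[unfolded invertible_mpt_UNIV_iff[OF assms(1)]]
  have "T ` Q = inv T -` Q \<inter> space M"
    using T assms(1) by (auto simp: bij_vimage_eq_inv_image bij_imp_bij_inv inv_inv_eq)
  then show *: "T ` Q \<in> sets M"
    using T assms(3) by auto
  have "emeasure M (T ` Q) = emeasure (distr M M T) (T ` Q)"
    using T by simp
  also have "\<dots> = emeasure M (T -` T ` Q)"
    using * T assms(1) by (subst emeasure_distr) auto
  finally show "emeasure M (T ` Q) = emeasure M Q"
    using T by (simp add: bij_is_inj inj_vimage_image_eq)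
qed


section \<open>Counting points\<close>

lemma num_points_eq_0_iff: "num_points \<xi> A = 0 \<longleftrightarrow> \<xi> \<inter> A = {}"
  by (simp add: num_points_def emeasure_count_space_eq_0)

lemma num_points_finite_iff: "num_points \<xi> A < \<infinity> \<longleftrightarrow> finite (\<xi> \<inter> A)"
  by (cases "finite (\<xi> \<inter> A)") (simp_all add: num_points_def of_nat_less_top)

lemma num_points_mono: "A \<subseteq> B \<Longrightarrow> num_points \<xi> A \<le> num_points \<xi> B"
  unfolding num_points_def by (rule emeasure_mono) auto

lemma num_points_vimage: "num_points (g -` \<xi>) Q = num_points \<xi> (g ` Q)" if "inj g"
proof -
  have "g ` (g -` \<xi> \<inter> Q) = \<xi> \<inter> g ` Q"
    by auto
  moreover have "inj_on g (g -` \<xi> \<inter> Q)"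
    using that by (rule inj_on_subset) auto
  ultimately have "finite (g -` \<xi> \<inter> Q) = finite (\<xi> \<inter> g ` Q)"
    and "card (g -` \<xi> \<inter> Q) = card (\<xi> \<inter> g ` Q)"
    by (metis finite_image_iff, metis card_image)
  then show ?thesis
    by (simp add: num_points_def emeasure_count_space)
qed

lemma space_config_space: "space config_space = configurations"
  by (auto simp: config_space_def intro!: space_measure_of)

text \<open>Boundedness matters: the \<open>\<sigma>\<close>-algebra of the configuration space is generated by the counts of
  bounded sets only.\<close>

lemma num_points_measurable_config:
  assumes "A \<in> sets borel" "bounded A"
  shows "(\<lambda>\<xi>. num_points \<xi> A) \<in> borel_measurable config_space"
proof (rule measurableI)
  fix E :: "ennreal set"
  assume E: "E \<in> sets borel"
  have "(\<lambda>\<xi>. num_points \<xi> A) -` E \<inter> configurations = {\<xi> \<in> configurations. num_points \<xi> A \<in> E}"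
    by auto
  also have "\<dots> \<in> sets config_space"
    unfolding config_space_def using assms E
    by (subst sets_measure_of) (auto intro!: sigma_sets.Basic)
  finally show "(\<lambda>\<xi>. num_points \<xi> A) -` E \<inter> space config_space \<in> sets config_space"
    by (simp add: space_config_space)
qed auto

lemma point_process_num_points:
  assumes "point_process \<mu> T P S N" "A \<in> sets borel" "bounded A"
  shows point_process_num_points_measurable: "(\<lambda>\<omega>. num_points (N \<omega>) A) \<in> borel_measurable P"
    and point_process_num_points_finite: "\<omega> \<in> space P \<Longrightarrow> num_points (N \<omega>) A < \<infinity>"
proof -
  have N: "N \<in> measurable P config_space"
    using assms(1) by (simp add: point_process_def)
  show "(\<lambda>\<omega>. num_points (N \<omega>) A) \<in> borel_measurable P"
    using measurable_compose[OF N num_points_measurable_config[OF assms(2,3)]] .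
  show "num_points (N \<omega>) A < \<infinity>" if "\<omega> \<in> space P"
    using measurable_space[OF N that] assms(2,3)
    by (auto simp: space_config_space configurations_def)
qed


section \<open>Detecting a common point by finite partitions\<close>

definition separates_points :: "(nat \<Rightarrow> 'a set) \<Rightarrow> bool" where
  "separates_points U \<longleftrightarrow> (\<forall>x y. x \<noteq> y \<longrightarrow> (\<exists>l. x \<in> U l \<and> y \<notin> U l))"

text \<open>Enumerate a countable base: a neighbourhood of \<open>x\<close> that misses \<open>y\<close> contains a base set
  around \<open>x\<close>.\<close>

lemma ex_open_separating_sequence:
  "\<exists>U :: nat \<Rightarrow> 'a::{second_countable_topology, t1_space} set.
     (\<forall>l. open (U l)) \<and> separates_points U"
proof -
  obtain \<B> :: "'a set set" where B: "countable \<B>" "topological_basis \<B>"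
    using ex_countable_basis by blast
  have ne: "\<B> \<noteq> {}"
    using topological_basisE[OF B(2) open_UNIV] by blast
  have "\<exists>l. x \<in> from_nat_into \<B> l \<and> y \<notin> from_nat_into \<B> l" if xy: "x \<noteq> y" for x y
  proof -
    obtain V where "open V" "x \<in> V" "y \<notin> V"
      using t1_space[OF xy] by blast
    moreover obtain C where "C \<in> \<B>" "x \<in> C" "C \<subseteq> V"
      using topological_basisE[OF B(2) \<open>open V\<close> \<open>x \<in> V\<close>] by blast
    moreover obtain l where "from_nat_into \<B> l = C"
      using from_nat_into_surj[OF B(1) \<open>C \<in> \<B>\<close>] by blast
    ultimately show ?thesis
      by blast
  qed
  moreover have "open (from_nat_into \<B> l)" for l
    using from_nat_into[OF ne] B(2) by (rule topological_basis_open[rotated])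
  ultimately show ?thesis
    unfolding separates_points_def by blast
qed

text \<open>For \<open>s \<subseteq> {..<m}\<close> these are the atoms of the algebra generated by \<open>U 0, \<dots>, U (m - 1)\<close>. This
  makes every partition finite, so no infinite sums over cells occur.\<close>

definition cell :: "(nat \<Rightarrow> 'a set) \<Rightarrow> nat \<Rightarrow> nat set \<Rightarrow> 'a set" where
  "cell U m s = {x. \<forall>l<m. x \<in> U l \<longleftrightarrow> l \<in> s}"

lemma disjoint_cells: "disjoint_family_on (\<lambda>s. D \<inter> cell U m s) (Pow {..<m})"
proof (unfold disjoint_family_on_def, intro ballI impI)
  fix s t
  assume "s \<in> Pow {..<m}" "t \<in> Pow {..<m}" "s \<noteq> t"
  then obtain l where "l < m" "l \<in> s \<longleftrightarrow> l \<notin> t"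
    by blast
  then show "(D \<inter> cell U m s) \<inter> (D \<inter> cell U m t) = {}"
    by (auto simp: cell_def)
qed

lemma Union_cells: "(\<Union>s\<in>Pow {..<m}. D \<inter> cell U m s) = D"
proof (intro equalityI subsetI)
  fix x
  assume "x \<in> D"
  then have "x \<in> D \<inter> cell U m {l. l < m \<and> x \<in> U l}"
    by (simp add: cell_def)
  then show "x \<in> (\<Union>s\<in>Pow {..<m}. D \<inter> cell U m s)"
    by (rule UN_I[rotated]) auto
qed auto

lemma sum_emeasure_cells:
  assumes "\<And>s. D \<inter> cell U m s \<in> sets M"
  shows "(\<Sum>s\<in>Pow {..<m}. emeasure M (D \<inter> cell U m s)) = emeasure M D"
  using sum_emeasure[OF _ disjoint_cells[of D U m], of M] assms Union_cells[of D U m]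
  by (simp only: image_subset_iff) simp

lemma sum_num_points_cells:
  "(\<Sum>s\<in>Pow {..<m}. num_points \<xi> (D \<inter> cell U m s)) = num_points \<xi> D"
  using sum_emeasure_cells[of "\<xi> \<inter> D" U m "count_space UNIV"]
  by (simp add: num_points_def Int_assoc)

text \<open>The number of tuples \<open>(x\<^sub>i)\<close> with \<open>x\<^sub>i \<in> F\<^sub>i \<inter> D\<close> all of whose entries lie in the same cell of the
  \<open>m\<close>-th partition.\<close>

definition cell_tuples ::
  "(nat \<Rightarrow> 'a set) \<Rightarrow> nat \<Rightarrow> 'i set \<Rightarrow> ('i \<Rightarrow> 'a set) \<Rightarrow> 'a set \<Rightarrow> ennreal" where
  "cell_tuples U m I F D = (\<Sum>s\<in>Pow {..<m}. \<Prod>i\<in>I. num_points (F i) (D \<inter> cell U m s))"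

text \<open>Keep the cell for one index only: the counts of the other factors are bounded by those of
  \<open>D\<close>, and the counts of the kept factor add up to that of \<open>D\<close>.\<close>

lemma cell_tuples_le:
  assumes "finite I" "I \<noteq> {}"
  shows "cell_tuples U m I F D \<le> (\<Prod>i\<in>I. num_points (F i) D)"
proof -
  obtain a where a: "a \<in> I"
    using assms by blast
  have "cell_tuples U m I F D \<le>
      (\<Sum>s\<in>Pow {..<m}. num_points (F a) (D \<inter> cell U m s) * (\<Prod>i\<in>I - {a}. num_points (F i) D))"
    unfolding cell_tuples_def prod.remove[OF assms(1) a]
    by (intro sum_mono mult_left_mono prod_mono_ennreal) (auto intro!: num_points_mono)
  also have "\<dots> = (\<Prod>i\<in>I. num_points (F i) D)"
    by (simp add: sum_distrib_right[symmetric] sum_num_points_cells prod.remove[OF assms(1) a])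
  finally show ?thesis .
qed

text \<open>The constant tuple at a common point stays in one cell of every partition.\<close>

lemma cell_tuples_nonzero:
  assumes "finite I" "x \<in> D" "\<And>i. i \<in> I \<Longrightarrow> x \<in> F i"
  shows "cell_tuples U m I F D \<noteq> 0"
proof -
  obtain s where s: "s \<in> Pow {..<m}" "x \<in> D \<inter> cell U m s"
    using Union_cells[of D U m] assms(2) by blast
  then have "num_points (F i) (D \<inter> cell U m s) \<noteq> 0" if "i \<in> I" for i
    using assms(3)[OF that] by (auto simp: num_points_eq_0_iff)
  then have "(\<Prod>i\<in>I. num_points (F i) (D \<inter> cell U m s)) \<noteq> 0"
    using assms(1) by simp
  then show ?thesis
    using s(1) by (auto simp: cell_tuples_def)
qed

lemma eventually_cell_eq:
  assumes "separates_points U" "finite G"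
  shows "\<forall>\<^sub>F m in sequentially. \<forall>x\<in>G. \<forall>y\<in>G. \<forall>s. x \<in> cell U m s \<longrightarrow> y \<in> cell U m s \<longrightarrow> x = y"
proof -
  have "\<forall>\<^sub>F m in sequentially. \<forall>s. x \<in> cell U m s \<longrightarrow> y \<in> cell U m s \<longrightarrow> x = y" for x y
  proof (cases "x = y")
    case False
    then obtain l where "x \<in> U l" "y \<notin> U l"
      using assms(1) by (auto simp: separates_points_def)
    then show ?thesis
      unfolding cell_def
      by (intro eventually_mono[OF eventually_gt_at_top[of l]]) auto
  qed simp
  then show ?thesis
    using assms(2) by (simp add: eventually_ball_finite)
qed

text \<open>Once the points of the finite set \<open>\<Union>\<^sub>i F\<^sub>i \<inter> D\<close> lie in different cells, a tuple inside one cell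
  is constant, and its entry is a common point of all the \<open>F\<^sub>i\<close>.\<close>

lemma eventually_cell_tuples_zero:
  assumes "separates_points U" "finite I" "I \<noteq> {}" "\<And>i. i \<in> I \<Longrightarrow> finite (F i \<inter> D)"
    and empty: "D \<inter> (\<Inter>i\<in>I. F i) = {}"
  shows "\<forall>\<^sub>F m in sequentially. cell_tuples U m I F D = 0"
proof -
  have fin: "finite (\<Union>i\<in>I. F i \<inter> D)"
    by (rule finite_UN_I[OF assms(2,4)])
  show ?thesis
    using eventually_cell_eq[OF assms(1) fin]
  proof eventually_elim
    case (elim m)
    have "(\<Prod>i\<in>I. num_points (F i) (D \<inter> cell U m s)) = 0" for s
    proof (rule ccontr)
      assume "(\<Prod>i\<in>I. num_points (F i) (D \<inter> cell U m s)) \<noteq> 0"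
      then have "\<forall>i\<in>I. \<exists>x. x \<in> F i \<inter> (D \<inter> cell U m s)"
        using assms(2) by (auto simp: num_points_eq_0_iff)
      then obtain x where x: "\<And>i. i \<in> I \<Longrightarrow> x i \<in> F i \<inter> (D \<inter> cell U m s)"
        by metis
      obtain a where a: "a \<in> I"
        using assms(3) by blast
      have "x i = x a" if "i \<in> I" for i
      proof -
        have "x i \<in> (\<Union>i\<in>I. F i \<inter> D)" "x a \<in> (\<Union>i\<in>I. F i \<inter> D)"
          and "x i \<in> cell U m s" "x a \<in> cell U m s"
          using x[OF that] x[OF a] that a by auto
        with elim show ?thesis
          by metis
      qed
      then have "x a \<in> F i" if "i \<in> I" for i
        using x[OF that] that by simp
      moreover have "x a \<in> D"
        using x[OF a] by simp
      ultimately show False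
        using empty by blast
    qed
    then show ?case
      by (simp add: cell_tuples_def)
  qed
qed


section \<open>The coincidence event\<close>

text \<open>Finiteness lets the partitions detect a common point: the event is the countable intersection of
  the events that the tuple count is nonzero.\<close>

lemma coincidence_event_measurable:
  fixes F :: "'i \<Rightarrow> 'w \<Rightarrow> 'a::{second_countable_topology, t1_space} set"
  assumes "finite I" "I \<noteq> {}"
    and D: "D \<in> sets borel"
    and meas: "\<And>i Q. i \<in> I \<Longrightarrow> Q \<in> sets borel \<Longrightarrow> Q \<subseteq> D \<Longrightarrow>
          (\<lambda>\<omega>. num_points (F i \<omega>) Q) \<in> borel_measurable P"
    and fin: "\<And>i \<omega>. i \<in> I \<Longrightarrow> \<omega> \<in> space P \<Longrightarrow> finite (F i \<omega> \<inter> D)"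
  shows "{\<omega> \<in> space P. D \<inter> (\<Inter>i\<in>I. F i \<omega>) \<noteq> {}} \<in> sets P"
proof -
  obtain U :: "nat \<Rightarrow> 'a set" where U: "\<And>l. open (U l)" "separates_points U"
    using ex_open_separating_sequence by blast
  have [measurable]: "U l \<in> sets borel" for l
    using U(1) by auto
  have "D \<inter> cell U m s \<in> sets borel" for m s
    unfolding cell_def using D by measurable
  then have Z: "(\<lambda>\<omega>. cell_tuples U m I (\<lambda>i. F i \<omega>) D) \<in> borel_measurable P" for m
    unfolding cell_tuples_def by (intro borel_measurable_sum borel_measurable_prod_ennreal meas) auto
  have "D \<inter> (\<Inter>i\<in>I. F i \<omega>) \<noteq> {} \<longleftrightarrow> (\<forall>m. cell_tuples U m I (\<lambda>i. F i \<omega>) D \<noteq> 0)"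
    if "\<omega> \<in> space P" for \<omega>
  proof
    assume "D \<inter> (\<Inter>i\<in>I. F i \<omega>) \<noteq> {}"
    then obtain x where "x \<in> D" "\<And>i. i \<in> I \<Longrightarrow> x \<in> F i \<omega>"
      by blast
    then show "\<forall>m. cell_tuples U m I (\<lambda>i. F i \<omega>) D \<noteq> 0"
      by (intro allI cell_tuples_nonzero[OF assms(1)])
  next
    assume *: "\<forall>m. cell_tuples U m I (\<lambda>i. F i \<omega>) D \<noteq> 0"
    show "D \<inter> (\<Inter>i\<in>I. F i \<omega>) \<noteq> {}"
    proof
      assume "D \<inter> (\<Inter>i\<in>I. F i \<omega>) = {}"
      then have "\<forall>\<^sub>F m in sequentially. cell_tuples U m I (\<lambda>i. F i \<omega>) D = 0"
        using fin[OF _ that] by (intro eventually_cell_tuples_zero[OF U(2) assms(1,2)])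
      then show False
        using * by (simp add: eventually_sequentially)
    qed
  qed
  then have "{\<omega> \<in> space P. D \<inter> (\<Inter>i\<in>I. F i \<omega>) \<noteq> {}} =
      {\<omega> \<in> space P. \<forall>m. cell_tuples U m I (\<lambda>i. F i \<omega>) D \<noteq> 0}"
    by blast
  also have "\<dots> \<in> sets P"
    using Z by measurable
  finally show ?thesis .
qed

text \<open>The core of the argument. Summed over the cells, the lower bound keeps the expected weighted
  tuple count above \<open>a \<mu>(D)\<close> for all partitions, whereas this expectation would tend to \<open>0\<close> by
  dominated convergence if there were almost surely no common point. The weight \<open>W\<close> carries the
  processes that take no part in the coincidence.\<close>

lemma coincidence_positive:
  fixes F :: "'i \<Rightarrow> 'w \<Rightarrow> 'a::{second_countable_topology, t1_space} set" and W :: "'w \<Rightarrow> ennreal"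
  assumes "finite I" "I \<noteq> {}"
    and M: "sets M = sets borel"
    and D: "D \<in> sets borel" "emeasure M D > 0"
    and meas: "\<And>i Q. i \<in> I \<Longrightarrow> Q \<in> sets borel \<Longrightarrow> Q \<subseteq> D \<Longrightarrow>
          (\<lambda>\<omega>. num_points (F i \<omega>) Q) \<in> borel_measurable P"
    and fin: "\<And>i \<omega>. i \<in> I \<Longrightarrow> \<omega> \<in> space P \<Longrightarrow> finite (F i \<omega> \<inter> D)"
    and W: "W \<in> borel_measurable P"
    and integrable: "(\<integral>\<^sup>+\<omega>. (\<Prod>i\<in>I. num_points (F i \<omega>) D) * W \<omega> \<partial>P) < \<infinity>"
    and a: "a > 0"
    and lower: "\<And>Q. Q \<in> sets borel \<Longrightarrow> Q \<subseteq> D \<Longrightarrow> emeasure M Q > 0 \<Longrightarrow>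
          a * emeasure M Q \<le> (\<integral>\<^sup>+\<omega>. (\<Prod>i\<in>I. num_points (F i \<omega>) Q) * W \<omega> \<partial>P)"
  shows "emeasure P {\<omega> \<in> space P. D \<inter> (\<Inter>i\<in>I. F i \<omega>) \<noteq> {}} > 0"
proof (rule ccontr)
  assume "\<not> ?thesis"
  moreover have "{\<omega> \<in> space P. D \<inter> (\<Inter>i\<in>I. F i \<omega>) \<noteq> {}} \<in> sets P"
    using assms(1,2) D(1) meas fin by (rule coincidence_event_measurable)
  ultimately have null: "{\<omega> \<in> space P. D \<inter> (\<Inter>i\<in>I. F i \<omega>) \<noteq> {}} \<in> null_sets P"
    by (simp add: null_setsI)
  obtain U :: "nat \<Rightarrow> 'a set" where U: "\<And>l. open (U l)" "separates_points U"
    using ex_open_separating_sequence by blast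
  have [measurable]: "U l \<in> sets borel" for l
    using U(1) by auto
  have cell: "D \<inter> cell U m s \<in> sets borel" for m s
    unfolding cell_def using D(1) by measurable
  define Z where "Z m \<omega> = cell_tuples U m I (\<lambda>i. F i \<omega>) D * W \<omega>" for m \<omega>
  have pm: "(\<lambda>\<omega>. (\<Prod>i\<in>I. num_points (F i \<omega>) Q) * W \<omega>) \<in> borel_measurable P"
    if "Q \<in> sets borel" "Q \<subseteq> D" for Q
    using that by (intro borel_measurable_times_ennreal borel_measurable_prod_ennreal meas W)
  have Z_sum: "Z m = (\<lambda>\<omega>. \<Sum>s\<in>Pow {..<m}. (\<Prod>i\<in>I. num_points (F i \<omega>) (D \<inter> cell U m s)) * W \<omega>)" for m
    by (simp add: Z_def cell_tuples_def sum_distrib_right fun_eq_iff)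
  have Z_meas: "Z m \<in> borel_measurable P" for m
    unfolding Z_sum using cell by (intro borel_measurable_sum pm) auto
  have lower_Z: "a * emeasure M D \<le> (\<integral>\<^sup>+\<omega>. Z m \<omega> \<partial>P)" for m
  proof -
    have "a * emeasure M D = (\<Sum>s\<in>Pow {..<m}. a * emeasure M (D \<inter> cell U m s))"
      using cell by (simp add: sum_distrib_left[symmetric] sum_emeasure_cells M)
    also have "\<dots> \<le> (\<Sum>s\<in>Pow {..<m}.
        \<integral>\<^sup>+\<omega>. (\<Prod>i\<in>I. num_points (F i \<omega>) (D \<inter> cell U m s)) * W \<omega> \<partial>P)"
    proof (rule sum_mono)
      fix s
      show "a * emeasure M (D \<inter> cell U m s) \<le>
          (\<integral>\<^sup>+\<omega>. (\<Prod>i\<in>I. num_points (F i \<omega>) (D \<inter> cell U m s)) * W \<omega> \<partial>P)"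
        \<comment> \<open>The lower bound is only given for cells of positive measure; for the others it is trivial.\<close>
        using lower[OF cell, of m s] by (cases "emeasure M (D \<inter> cell U m s) = 0") (auto simp: zero_less_iff_neq_zero)
    qed
    also have "\<dots> = (\<integral>\<^sup>+\<omega>. Z m \<omega> \<partial>P)"
      unfolding Z_sum using cell by (intro nn_integral_sum[symmetric] pm) auto
    finally show ?thesis .
  qed
  have "(\<lambda>m. \<integral>\<^sup>+\<omega>. Z m \<omega> \<partial>P) \<longlonglongrightarrow> (\<integral>\<^sup>+\<omega>. 0 \<partial>P)"
  proof (rule nn_integral_dominated_convergence)
    show "AE \<omega> in P. Z m \<omega> \<le> (\<Prod>i\<in>I. num_points (F i \<omega>) D) * W \<omega>" for m
      unfolding Z_def by (intro AE_I2 mult_right_mono cell_tuples_le assms(1,2)) auto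
    show "AE \<omega> in P. (\<lambda>m. Z m \<omega>) \<longlonglongrightarrow> 0"
      using AE_not_in[OF null]
    proof (rule AE_mp, intro AE_I2 impI)
      fix \<omega>
      assume w: "\<omega> \<in> space P" "\<omega> \<notin> {\<omega> \<in> space P. D \<inter> (\<Inter>i\<in>I. F i \<omega>) \<noteq> {}}"
      have "\<forall>\<^sub>F m in sequentially. cell_tuples U m I (\<lambda>i. F i \<omega>) D = 0"
        using w fin[OF _ w(1)] by (intro eventually_cell_tuples_zero[OF U(2) assms(1,2)]) auto
      then show "(\<lambda>m. Z m \<omega>) \<longlonglongrightarrow> 0"
        by (intro tendsto_eventually) (auto simp: Z_def elim!: eventually_mono)
    qed
  qed (use Z_meas pm[OF D(1)] integrable in auto)
  then have "a * emeasure M D \<le> 0"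
    using lower_Z by (intro Lim_bounded2[where N = 0]) auto
  then show False
    using a D(2) by (auto simp: zero_less_iff_neq_zero)
qed


section \<open>Integrability of products\<close>

text \<open>Every factor is at most the largest one. This cheap replacement for Hoelder's inequality is
  enough, because all moments are finite.\<close>

lemma prod_le_sum_power_card:
  fixes f :: "'i \<Rightarrow> ennreal"
  assumes "finite I" "I \<noteq> {}"
  shows "(\<Prod>i\<in>I. f i) \<le> (\<Sum>i\<in>I. f i ^ card I)"
proof -
  have "Max (f ` I) \<in> f ` I"
    using assms by (intro Max_in) auto
  then obtain a where a: "a \<in> I" "f a = Max (f ` I)"
    by (metis imageE)
  have "(\<Prod>i\<in>I. f i) \<le> (\<Prod>i\<in>I. f a)"
    using assms a by (intro prod_mono_ennreal) auto
  also have "\<dots> = f a ^ card I"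
    by simp
  also have "\<dots> \<le> (\<Sum>i\<in>I. f i ^ card I)"
    using assms a by (intro member_le_sum) auto
  finally show ?thesis .
qed

lemma nn_integral_prod_num_points_finite:
  assumes "finite I" "I \<noteq> {}"
    and "\<And>i. i \<in> I \<Longrightarrow> moments_of_all_orders \<mu> P (N i)"
    and "\<And>i. i \<in> I \<Longrightarrow> A i \<in> fin_pos_sets \<mu>"
    and meas: "\<And>i. i \<in> I \<Longrightarrow> (\<lambda>\<omega>. num_points (N i \<omega>) (A i)) \<in> borel_measurable P"
  shows "(\<integral>\<^sup>+\<omega>. (\<Prod>i\<in>I. num_points (N i \<omega>) (A i)) \<partial>P) < \<infinity>"
proof -
  have "card I \<ge> 1"
    using assms(1,2) by (simp add: Suc_le_eq card_gt_0_iff)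
  then have fin: "(\<integral>\<^sup>+\<omega>. num_points (N i \<omega>) (A i) ^ card I \<partial>P) < \<infinity>" if "i \<in> I" for i
    using assms(3)[OF that] assms(4)[OF that] by (simp add: moments_of_all_orders_def)
  have "(\<integral>\<^sup>+\<omega>. (\<Prod>i\<in>I. num_points (N i \<omega>) (A i)) \<partial>P)
      \<le> (\<integral>\<^sup>+\<omega>. (\<Sum>i\<in>I. num_points (N i \<omega>) (A i) ^ card I) \<partial>P)"
    using assms(1,2) by (intro nn_integral_mono prod_le_sum_power_card)
  also have "\<dots> = (\<Sum>i\<in>I. \<integral>\<^sup>+\<omega>. num_points (N i \<omega>) (A i) ^ card I \<partial>P)"
    by (intro nn_integral_sum borel_measurable_power_ennreal meas)
  also have "\<dots> < \<infinity>"
    using fin assms(1) by simp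
  finally show ?thesis .
qed

text \<open>The cubes over the balls around \<open>z\<close> exhaust the product. For \<open>I = {}\<close> each cube is the
  whole one-point space.\<close>

lemma ex_ball_emeasure_pos:
  fixes \<nu> :: "('i \<Rightarrow> 'a::metric_space) measure"
  assumes "finite I" "sets \<nu> = sets (Pi\<^sub>M I (\<lambda>_. borel))"
    and "emeasure \<nu> (space \<nu>) \<noteq> 0"
  shows "\<exists>r::nat. emeasure \<nu> (\<Pi>\<^sub>E i\<in>I. ball z (real r)) > 0"
proof (rule ccontr)
  assume "\<not> ?thesis"
  then have zero: "emeasure \<nu> (\<Pi>\<^sub>E i\<in>I. ball z (real r)) = 0" for r :: nat
    by (simp add: not_gr_zero)
  have "space \<nu> = (\<Pi>\<^sub>E i\<in>I. UNIV)"
    using sets_eq_imp_space_eq[OF assms(2)] by (simp add: space_PiM)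
  also have "\<dots> = (\<Union>r::nat. \<Pi>\<^sub>E i\<in>I. ball z (real r))"
  proof (intro equalityI subsetI)
    fix x :: "'i \<Rightarrow> 'a"
    assume x: "x \<in> (\<Pi>\<^sub>E i\<in>I. UNIV)"
    obtain r :: nat where r: "(\<Sum>i\<in>I. dist z (x i)) < real r"
      using reals_Archimedean2 by blast
    have "dist z (x i) < real r" if "i \<in> I" for i
      using r member_le_sum[OF that, of "\<lambda>i. dist z (x i)"] assms(1) by simp
    then show "x \<in> (\<Union>r::nat. \<Pi>\<^sub>E i\<in>I. ball z (real r))"
      using x by (auto simp: PiE_iff)
  qed (auto simp: PiE_iff)
  also have "emeasure \<nu> \<dots> = 0"
    using zero assms(1)
    by (intro emeasure_UN_eq_0) (auto simp: assms(2) intro!: sets_PiM_I_finite)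
  finally show False
    using assms(3) by simp
qed


section \<open>Positive probability of a coincidence\<close>

theorem lemma2p6:
  fixes \<mu> :: "'a::polish_space measure" and T :: "'a \<Rightarrow> 'a"
    and P :: "'w measure" and S :: "'w \<Rightarrow> 'w"
    and N :: "nat \<Rightarrow> 'w \<Rightarrow> 'a set"
    and n j :: nat and k :: "nat \<Rightarrow> int" and c :: real
    and \<nu> :: "(nat \<Rightarrow> 'a) measure"
  assumes "infinite_system \<mu> T"
    and "prob_space P" and "invertible_mpt P S" and "ergodic P S"
    and "\<And>i. i \<in> {1..n} \<Longrightarrow> point_process \<mu> T P S (N i)"
    and "\<And>i. i \<in> {1..n} \<Longrightarrow> moments_of_all_orders \<mu> P (N i)"
    and "c > 0" and "2 \<le> j" and "j \<le> n"
    and "product_invariant T {j+1..n} \<nu>"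
    and "sigma_finite_measure \<nu>"
    and "emeasure \<nu> (space \<nu>) \<noteq> 0"
    and "\<And>A. (\<And>i. i \<in> {1..n} \<Longrightarrow> A i \<in> fin_pos_sets \<mu>) \<Longrightarrow>
           (\<integral>\<^sup>+\<omega>. (\<Prod>i=1..n. num_points (N i \<omega>) (A i)) \<partial>P) \<ge>
             ennreal c * emeasure \<mu> (A 1 \<inter> (\<Inter>i\<in>{2..j}. int_iter T (k i) -` A i))
               * emeasure \<nu> (\<Pi>\<^sub>E i\<in>{j+1..n}. A i)"
    and "A \<in> fin_pos_sets \<mu>"
  shows "\<P>(\<omega> in P. A \<inter> N 1 \<omega> \<inter> (\<Inter>i\<in>{2..j}. int_iter T (k i) -` N i \<omega>) \<noteq> {}) > 0"
proof -
  interpret P: prob_space P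
    by fact
  have \<mu>_sets: "sets \<mu> = sets borel" and bfin: "boundedly_finite \<mu>"
    and inf: "emeasure \<mu> UNIV = \<infinity>" and T: "invertible_mpt \<mu> T"
    using assms(1) by (auto simp: infinite_system_def)
  have \<mu>_space: "space \<mu> = UNIV"
    using sets_eq_imp_space_eq[OF \<mu>_sets] by simp
  define I where "I = {1..j}"
  have I: "finite I" "I \<noteq> {}" "I \<subseteq> {1..n}" "I = insert 1 {2..j}"
    using assms(8,9) by (auto simp: I_def)
  (* Setting k 1 to 0 makes g 1 the identity, so that N 1 is treated like the other processes. *)
  define g where "g i = int_iter T ((k(1 := 0)) i)" for i
  have g_1: "g 1 = id" and g_k: "\<And>i. i \<in> {2..j} \<Longrightarrow> g i = int_iter T (k i)"
    by (auto simp: g_def int_iter_def)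
  have g: "invertible_mpt \<mu> (g i)" for i
    unfolding g_def by (rule invertible_mpt_int_iter[OF \<mu>_space T])
  then have g_inj: "inj (g i)" and g_meas: "g i \<in> borel_measurable borel" for i
    by (auto simp: invertible_mpt_UNIV_iff[OF \<mu>_space] bij_is_inj measurable_cong_sets[OF \<mu>_sets \<mu>_sets])
  define F where "F i \<omega> = g i -` N i \<omega>" for i \<omega>
  have event: "A \<inter> N 1 \<omega> \<inter> (\<Inter>i\<in>{2..j}. int_iter T (k i) -` N i \<omega>) = A \<inter> (\<Inter>i\<in>I. F i \<omega>)" for \<omega>
    using g_1 g_k by (auto simp: I(4) F_def)
  have A: "A \<in> sets borel" "0 < emeasure \<mu> A" "emeasure \<mu> A < \<infinity>"
    using assms(14) by (auto simp: fin_pos_sets_def \<mu>_sets)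

  (* On D r all images under the g i lie in the ball of radius r. *)
  define z :: 'a where "z = undefined"
  define D where "D r = A \<inter> (\<Inter>i\<in>I. g i -` ball z (real r))" for r :: nat
  have "g i -` ball z (real r) \<in> sets borel" for i r
    using measurable_sets[OF g_meas, of "ball z (real r)"] by simp
  then have D_sets: "D r \<in> sets borel" for r
    unfolding D_def using A(1) I(1,2) by (intro sets.Int sets.finite_INT) auto
  have D_A: "D r \<subseteq> A" for r
    by (auto simp: D_def)
  have A_Un: "A = (\<Union>r. D r)"
  proof (intro equalityI subsetI)
    fix x
    assume x: "x \<in> A"
    obtain r :: nat where r: "(\<Sum>i\<in>I. dist z (g i x)) < real r"
      using reals_Archimedean2 by blast
    have "dist z (g i x) < real r" if "i \<in> I" for i
      using r member_le_sum[OF that, of "\<lambda>i. dist z (g i x)"] I(1) by simp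
    then show "x \<in> (\<Union>r. D r)"
      using x by (auto simp: D_def)
  qed (use D_A in auto)

  have image: "g i ` Q \<in> sets borel" "bounded (g i ` Q)" "emeasure \<mu> (g i ` Q) = emeasure \<mu> Q"
    if "i \<in> I" "Q \<in> sets borel" "Q \<subseteq> D r" for i Q r
  proof -
    show "g i ` Q \<in> sets borel" "emeasure \<mu> (g i ` Q) = emeasure \<mu> Q"
      using invertible_mpt_image_sets[OF \<mu>_space g] invertible_mpt_emeasure_image[OF \<mu>_space g] that(2)
      by (auto simp: \<mu>_sets)
    have "g i ` Q \<subseteq> ball z (real r)"
      using that by (auto simp: D_def)
    then show "bounded (g i ` Q)"
      by (rule bounded_subset[OF bounded_ball])
  qed
  have F_num: "num_points (F i \<omega>) Q = num_points (N i \<omega>) (g i ` Q)" for i \<omega> Q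
    unfolding F_def by (rule num_points_vimage[OF g_inj])
  have F_meas: "(\<lambda>\<omega>. num_points (F i \<omega>) Q) \<in> borel_measurable P"
    if "i \<in> I" "Q \<in> sets borel" "Q \<subseteq> D r" for i Q r
    unfolding F_num
    by (rule point_process_num_points_measurable[OF assms(5)]) (use image[OF that] that(1) I(3) in auto)
  have F_fin: "finite (F i \<omega> \<inter> D r)" if "i \<in> I" "\<omega> \<in> space P" for i \<omega> r
    unfolding num_points_finite_iff[symmetric] F_num
    by (rule point_process_num_points_finite[OF assms(5) _ _ that(2)])
      (use image[OF that(1) D_sets order_refl, of r] that(1) I(3) in auto)

  define E where "E C = {\<omega> \<in> space P. C \<inter> (\<Inter>i\<in>I. F i \<omega>) \<noteq> {}}" for C
  have "E (D r) \<in> sets P" for r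
    unfolding E_def using I(1,2) D_sets F_meas F_fin by (rule coincidence_event_measurable)
  moreover have "E A = (\<Union>r. E (D r))"
    unfolding E_def by (subst A_Un) auto
  ultimately have E_sets: "E A \<in> sets P"
    by auto

  (* By monotonicity of the event it is enough to find a coincidence in one set D r. *)
  have "\<exists>r. emeasure \<mu> (D r) > 0"
  proof (rule ccontr)
    assume "\<nexists>r. emeasure \<mu> (D r) > 0"
    then have "emeasure \<mu> (\<Union>r. D r) = 0"
      using D_sets by (intro emeasure_UN_eq_0) (auto simp: \<mu>_sets)
    then show False
      using A(2) A_Un by simp
  qed
  then obtain r where r: "emeasure \<mu> (D r) > 0"
    by blast

  have \<nu>_sets: "sets \<nu> = sets (Pi\<^sub>M {j+1..n} (\<lambda>_. borel))"
    using assms(10) by (simp add: product_invariant_def)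
  obtain r1 :: nat where r1: "emeasure \<nu> (\<Pi>\<^sub>E i\<in>{j+1..n}. ball z (real r1)) > 0"
    using ex_ball_emeasure_pos[OF finite_atLeastAtMost \<nu>_sets assms(12)] by blast
  have "\<exists>r2::nat. emeasure \<mu> (ball z (real r2)) > 0"
  proof (rule ccontr)
    assume "\<nexists>r2::nat. emeasure \<mu> (ball z (real r2)) > 0"
    then have "emeasure \<mu> (\<Union>r2::nat. ball z (real r2)) = 0"
      by (intro emeasure_UN_eq_0) (auto simp: \<mu>_sets)
    moreover have "(\<Union>r2::nat. ball z (real r2)) = UNIV"
      using reals_Archimedean2 by auto
    ultimately show False
      using inf by simp
  qed
  then obtain r2 :: nat where r2: "emeasure \<mu> (ball z (real r2)) > 0"
    by blast
  (* The ball B must also have positive \<mu>-measure, as the moment inequality needs it to be in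
     fin_pos_sets \<mu>. *)
  define B where "B = ball z (real (max r1 r2))"
  have "emeasure \<nu> (\<Pi>\<^sub>E i\<in>{j+1..n}. ball z (real r1)) \<le> emeasure \<nu> (\<Pi>\<^sub>E i\<in>{j+1..n}. B)"
    by (rule emeasure_mono) (auto simp: B_def \<nu>_sets intro!: PiE_mono subset_ball sets_PiM_I_finite)
  then have \<nu>_B: "emeasure \<nu> (\<Pi>\<^sub>E i\<in>{j+1..n}. B) > 0"
    using r1 by order
  have "emeasure \<mu> (ball z (real r2)) \<le> emeasure \<mu> B"
    by (rule emeasure_mono) (auto simp: B_def \<mu>_sets intro!: subset_ball)
  then have \<mu>_B: "emeasure \<mu> B > 0"
    using r2 by order
  have B: "B \<in> sets borel" "bounded B"
    by (auto simp: B_def)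
  have B_fin_pos: "B \<in> fin_pos_sets \<mu>"
    using \<mu>_B B bfin by (auto simp: fin_pos_sets_def boundedly_finite_def \<mu>_sets)

  define W where "W \<omega> = (\<Prod>i\<in>{j+1..n}. num_points (N i \<omega>) B)" for \<omega>
  have W: "W \<in> borel_measurable P"
    unfolding W_def using B
    by (intro borel_measurable_prod_ennreal point_process_num_points_measurable[OF assms(5)]) auto
  define A' where "A' Q i = (if i \<in> I then g i ` Q else B)" for Q i
  have split: "{1..n} = I \<union> {j+1..n}" "I \<inter> {j+1..n} = {}"
    using assms(8,9) by (auto simp: I_def)
  have prod_A': "(\<Prod>i=1..n. num_points (N i \<omega>) (A' Q i)) = (\<Prod>i\<in>I. num_points (F i \<omega>) Q) * W \<omega>" for Q \<omega>
    unfolding split(1) W_def using split(2) I(1)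
    by (subst prod.union_disjoint) (auto simp: A'_def F_num I_def intro!: arg_cong2[where f = times] prod.cong)
  have A'_fin_pos: "A' Q i \<in> fin_pos_sets \<mu>"
    if "Q \<in> sets borel" "Q \<subseteq> D r" "emeasure \<mu> Q > 0" for Q i
  proof -
    have "emeasure \<mu> Q \<le> emeasure \<mu> A"
      using that(2) D_A A(1) by (intro emeasure_mono) (auto simp: \<mu>_sets)
    then have "emeasure \<mu> Q < \<infinity>"
      using A(3) by order
    then show ?thesis
      using image[OF _ that(1,2)] that(3) B_fin_pos by (auto simp: A'_def fin_pos_sets_def \<mu>_sets)
  qed
  have A'_Inter: "A' Q 1 \<inter> (\<Inter>i\<in>{2..j}. int_iter T (k i) -` A' Q i) = Q" for Q
  proof -
    have "int_iter T (k i) -` A' Q i = Q" if "i \<in> {2..j}" for i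
      using that by (simp add: A'_def I(4) g_k[symmetric] inj_vimage_image_eq[OF g_inj])
    then show ?thesis
      using g_1 by (auto simp: A'_def I(4))
  qed
  have A'_PiE: "(\<Pi>\<^sub>E i\<in>{j+1..n}. A' Q i) = (\<Pi>\<^sub>E i\<in>{j+1..n}. B)" for Q
    by (rule PiE_cong) (auto simp: A'_def I_def)

  have "emeasure P (E (D r)) > 0"
    unfolding E_def
  proof (rule coincidence_positive[OF I(1,2) \<mu>_sets D_sets r F_meas F_fin W])
    have "(\<integral>\<^sup>+\<omega>. (\<Prod>i=1..n. num_points (N i \<omega>) (A' (D r) i)) \<partial>P) < \<infinity>"
    proof (rule nn_integral_prod_num_points_finite[OF _ _ assms(6)])
      show "A' (D r) i \<in> fin_pos_sets \<mu>" for i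
        using A'_fin_pos[OF D_sets order_refl r] .
      show "(\<lambda>\<omega>. num_points (N i \<omega>) (A' (D r) i)) \<in> borel_measurable P" if "i \<in> {1..n}" for i
        using image[OF _ D_sets order_refl, of i r] B
        by (intro point_process_num_points_measurable[OF assms(5)[OF that]]) (auto simp: A'_def)
    qed (use assms(8,9) in auto)
    then show "(\<integral>\<^sup>+\<omega>. (\<Prod>i\<in>I. num_points (F i \<omega>) (D r)) * W \<omega> \<partial>P) < \<infinity>"
      by (simp only: prod_A')
    show "ennreal c * emeasure \<nu> (\<Pi>\<^sub>E i\<in>{j+1..n}. B) > 0"
      using assms(7) \<nu>_B by (simp add: ennreal_zero_less_mult_iff)
    show "ennreal c * emeasure \<nu> (\<Pi>\<^sub>E i\<in>{j+1..n}. B) * emeasure \<mu> Q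
        \<le> (\<integral>\<^sup>+\<omega>. (\<Prod>i\<in>I. num_points (F i \<omega>) Q) * W \<omega> \<partial>P)"
      if "Q \<in> sets borel" "Q \<subseteq> D r" "emeasure \<mu> Q > 0" for Q
      using assms(13)[of "A' Q", OF A'_fin_pos[OF that]]
      unfolding A'_Inter A'_PiE prod_A' by (simp only: ac_simps)
  qed
  also have "emeasure P (E (D r)) \<le> emeasure P (E A)"
    using D_A[of r] by (intro emeasure_mono E_sets) (auto simp: E_def)
  finally show ?thesis
    unfolding event E_def[symmetric] by (simp add: P.emeasure_eq_measure)
qed

end
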